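(* Let $\Psi=(\psi_n)_{n=1}^\infty$ and $\Phi=(\phi_n)_{n=1}^\infty$ be Bessel sequences in separable Hilbert spaces $\mathcal{H}_1$ and $\mathcal{H}_2$, respectively, and let $m=(m_n)_{n=1}^\infty\subseteq\mathbb{C}$ be bounded. Assume that the multiplier $M:=M_{m,\Phi,\Psi}:\mathcal{H}_1\to\mathcal{H}_2$ has closed range, and let $W\subseteq\mathcal{H}_1$, $V\subseteq\mathcal{H}_2$ be closed subspaces with $\mathcal{H}_1=W\oplus\ker(M)$ and $\mathcal{H}_2=\operatorname{ran}(M)\oplus V$. Let $M^{\#}_{W,V}:\mathcal{H}_2\to\mathcal{H}_1$ be the oblique pseudoinverse of $M$ on $W$ along $V$, and put $\Psi^{\#}_{W,V}:=(M^{\#}_{W,V}(m_n\phi_n))_{n=1}^\infty$ and $\Phi^{\#}_{W,V}:=((M^{\#}_{W,V})^*(\overline{m_n}\psi_n))_{n=1}^\infty$. Then the following hold. (i) $\pi^*_{W,\ker(M)}\Psi$ is a frame for $\ker(M)^\perp$. (ii) $\pi_{\operatorname{ran}(M),V}\Phi$ is a frame for $\operatorname{ran}(M)$. (iii) $\pi^*_{W,\ker(M)}\Psi$ (a frame for $\ker(M)^\perp$) and $\Psi^{\#}_{W,V}$ (a frame for $W$) are a pair of oblique dual frames. (iv) $\pi_{\operatorname{ran}(M),V}\Phi$ (a frame for $\operatorname{ran}(M)$) and $\Phi^{\#}_{W,V}$ (a frame for $V^\perp$) are a pair of oblique dual frames.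
   Context: Here $X\oplus Y$ denotes a direct sum, not necessarily orthogonal. A sequence $(x_n)$ in a closed subspace $X$ of a Hilbert space $\mathcal{H}$ is a Bessel sequence in $X$ if there is $B>0$ with $\sum_n|\langle h,x_n\rangle|^2\le B\|h\|^2$ for all $h\in X$ (it is then Bessel in $\mathcal{H}$), and a frame for $X$ if moreover $A\|h\|^2\le\sum_n|\langle h,x_n\rangle|^2$ for some $A>0$ and all $h\in X$. For a Bessel sequence $F=(f_n)$ in $\mathcal{H}$, $T_F:\ell^2(\mathbb{N})\to\mathcal{H}$, $T_F(c_n)=\sum_n c_nf_n$, is the synthesis operator; its adjoint is $T_F^*h=(\langle h,f_n\rangle)_n$. For sequences $\Psi$ in $\mathcal{H}_1$, $\Phi$ in $\mathcal{H}_2$ and scalars $m$, the multiplier is $M_{m,\Phi,\Psi}h=\sum_n m_n\langle h,\psi_n\rangle\phi_n$. For Bessel sequences and bounded $m$ it is a bounded operator $\mathcal{H}_1\to\mathcal{H}_2$. If $\mathcal{H}=X\oplus Z$ with $X,Z$ closed, $\pi_{X,Z}$ is the oblique projection onto $X$ along $Z$: $\pi_{X,Z}(x+z)=x$ for $x\in X$, $z\in Z$. For an operator $L$ and sequence $F=(f_n)$, $LF:=(Lf_n)_n$. Oblique dual frames: let $W_1,W_2$ be closed subspaces of $\mathcal{H}$ with $\mathcal{H}=W_1\oplus W_2^\perp$. If $F$ is a frame for $W_1$ and $G$ is a frame for $W_2$, then $F$ is an oblique dual frame of $G$ on $W_1$ if $T_FT_G^*=\pi_{W_1,W_2^\perp}$.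 This is equivalent to $G$ being an oblique dual frame of $F$ on $W_2$ (i.e. $T_GT_F^*=\pi_{W_2,W_1^\perp}$), and $F,G$ are then called a pair of oblique dual frames. Oblique pseudoinverse: for a bounded operator $M:\mathcal{H}_1\to\mathcal{H}_2$ with closed range and closed subspaces $W,V$ with $\mathcal{H}_1=W\oplus\ker(M)$, $\mathcal{H}_2=\operatorname{ran}(M)\oplus V$, each $y\in\mathcal{H}_2$ can be written as $y=Mx_y+z_y$ with unique $x_y\in W$, $z_y\in V$; the oblique pseudoinverse of $M$ on $W$ along $V$ is $M^{\#}_{W,V}y:=x_y$. It is a bounded linear operator $\mathcal{H}_2\to\mathcal{H}_1$. *)

theory Defs
  imports "HOL-Analysis.Analysis"
begin

section \<open>Complex Hilbert spaces\<close>

text \<open>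
  The distribution only has real inner product spaces. The inner product below is linear in its
  first and conjugate-linear in its second argument; the norm (and hence the topology) is the one
  induced by it. The Hilbert spaces need not be infinite-dimensional.
\<close>

class complex_vector = real_vector +
  fixes scaleC :: "complex \<Rightarrow> 'a \<Rightarrow> 'a"  (infixr "*\<^sub>C" 75)
  assumes scaleC_add_right: "a *\<^sub>C (x + y) = a *\<^sub>C x + a *\<^sub>C y"
    and scaleC_add_left: "(a + b) *\<^sub>C x = a *\<^sub>C x + b *\<^sub>C x"
    and scaleC_scaleC: "a *\<^sub>C (b *\<^sub>C x) = (a * b) *\<^sub>C x"
    and scaleC_one: "1 *\<^sub>C x = x"
    and scaleC_of_real: "complex_of_real r *\<^sub>C x = r *\<^sub>R x"

class complex_inner = complex_vector + real_normed_vector +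
  fixes cinner :: "'a \<Rightarrow> 'a \<Rightarrow> complex"
  assumes cinner_commute: "cinner x y = cnj (cinner y x)"
    and cinner_add_left: "cinner (x + y) z = cinner x z + cinner y z"
    and cinner_scaleC_left: "cinner (a *\<^sub>C x) y = a * cinner x y"
    and norm_eq_sqrt_cinner: "norm x = sqrt (Re (cinner x x))"

class chilbert_space = complex_inner + banach

instantiation complex :: chilbert_space
begin

definition scaleC_complex :: "complex \<Rightarrow> complex \<Rightarrow> complex"
  where "scaleC_complex a x = a * x"

definition cinner_complex :: "complex \<Rightarrow> complex \<Rightarrow> complex"
  where "cinner_complex x y = x * cnj y"

instance
  by standard
    (simp_all add: scaleC_complex_def cinner_complex_def algebra_simps scaleR_conv_of_real
      cmod_def power2_eq_square)

end

definition closed_csubspace :: "'a::complex_inner set \<Rightarrow> bool"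
  where "closed_csubspace S \<longleftrightarrow>
    0 \<in> S \<and> (\<forall>x\<in>S. \<forall>y\<in>S. x + y \<in> S) \<and> (\<forall>a. \<forall>x\<in>S. a *\<^sub>C x \<in> S) \<and> closed S"

definition ocomp :: "'a::complex_inner set \<Rightarrow> 'a set"
  where "ocomp S = {x. \<forall>y\<in>S. cinner x y = 0}"

definition ker :: "('a \<Rightarrow> 'b::zero) \<Rightarrow> 'a set"
  where "ker T = {x. T x = 0}"

text \<open>Not necessarily orthogonal.\<close>

definition direct_sum :: "'a::complex_inner set \<Rightarrow> 'a set \<Rightarrow> bool"
  where "direct_sum X Z \<longleftrightarrow> X \<inter> Z = {0} \<and> (\<forall>h. \<exists>x\<in>X. \<exists>z\<in>Z. h = x + z)"

text \<open>
  Unique whenever it exists; it exists for bounded operators between Hilbert spaces.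
\<close>

definition cadjoint :: "('a::complex_inner \<Rightarrow> 'b::complex_inner) \<Rightarrow> 'b \<Rightarrow> 'a"
  where "cadjoint T = (THE S. \<forall>x y. cinner (T x) y = cinner x (S y))"

text \<open>\<open>oblique_proj X Z\<close> is the projection onto \<open>X\<close> along \<open>Z\<close>.\<close>

definition oblique_proj :: "'a::complex_inner set \<Rightarrow> 'a set \<Rightarrow> 'a \<Rightarrow> 'a"
  where "oblique_proj X Z h = (THE x. x \<in> X \<and> (\<exists>z\<in>Z. h = x + z))"

text \<open>\<open>oblique_pinv M W V\<close> is the oblique pseudoinverse of \<open>M\<close> on \<open>W\<close> along \<open>V\<close>.\<close>

definition oblique_pinv ::
  "('a::complex_inner \<Rightarrow> 'b::complex_inner) \<Rightarrow> 'a set \<Rightarrow> 'b set \<Rightarrow> 'b \<Rightarrow> 'a"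
  where "oblique_pinv M W V y = (THE x. x \<in> W \<and> (\<exists>z\<in>V. y = M x + z))"


section \<open>Bessel sequences, frames and multipliers\<close>

text \<open>
  Summability is stated explicitly because \<^const>\<open>suminf\<close> is unspecified on divergent series.
\<close>

definition bessel_in :: "'a::complex_inner set \<Rightarrow> (nat \<Rightarrow> 'a) \<Rightarrow> bool"
  where "bessel_in X F \<longleftrightarrow> closed_csubspace X \<and> range F \<subseteq> X \<and>
    (\<exists>B>0. \<forall>h\<in>X. summable (\<lambda>n. (cmod (cinner h (F n)))\<^sup>2) \<and>
      (\<Sum>n. (cmod (cinner h (F n)))\<^sup>2) \<le> B * (norm h)\<^sup>2)"

definition frame_for :: "'a::complex_inner set \<Rightarrow> (nat \<Rightarrow> 'a) \<Rightarrow> bool"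
  where "frame_for X F \<longleftrightarrow> bessel_in X F \<and>
    (\<exists>A>0. \<forall>h\<in>X. A * (norm h)\<^sup>2 \<le> (\<Sum>n. (cmod (cinner h (F n)))\<^sup>2))"

definition ell2 :: "(nat \<Rightarrow> complex) set"
  where "ell2 = {c. summable (\<lambda>n. (cmod (c n))\<^sup>2)}"

text \<open>
  The synthesis operator \<open>T\<^sub>F\<close>, to be applied to sequences in \<^const>\<open>ell2\<close>, and the analysis
  operator \<open>T\<^sub>F\<^sup>*\<close>; the lemmas at the end of this theory show that they are well-defined and adjoint
  to each other.
\<close>

definition synthesis :: "(nat \<Rightarrow> 'a::complex_inner) \<Rightarrow> (nat \<Rightarrow> complex) \<Rightarrow> 'a"
  where "synthesis F c = (\<Sum>n. c n *\<^sub>C F n)"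

definition analysis :: "(nat \<Rightarrow> 'a::complex_inner) \<Rightarrow> 'a \<Rightarrow> nat \<Rightarrow> complex"
  where "analysis F h = (\<lambda>n. cinner h (F n))"

definition multiplier ::
  "(nat \<Rightarrow> complex) \<Rightarrow> (nat \<Rightarrow> 'b::complex_inner) \<Rightarrow> (nat \<Rightarrow> 'a::complex_inner) \<Rightarrow> 'a \<Rightarrow> 'b"
  where "multiplier m \<Phi> \<Psi> h = (\<Sum>n. (m n * cinner h (\<Psi> n)) *\<^sub>C \<Phi> n)"

text \<open>\<open>F\<close> is an oblique dual frame of \<open>G\<close> on \<open>W1\<close>.\<close>

definition oblique_dual_frame ::
  "'a::complex_inner set \<Rightarrow> 'a set \<Rightarrow> (nat \<Rightarrow> 'a) \<Rightarrow> (nat \<Rightarrow> 'a) \<Rightarrow> bool"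
  where "oblique_dual_frame W1 W2 F G \<longleftrightarrow>
    closed_csubspace W1 \<and> closed_csubspace W2 \<and> direct_sum W1 (ocomp W2) \<and>
    frame_for W1 F \<and> frame_for W2 G \<and>
    (\<forall>h. synthesis F (analysis G h) = oblique_proj W1 (ocomp W2) h)"

text \<open>
  In a Hilbert space the two conjuncts are equivalent.
\<close>

definition oblique_dual_pair ::
  "'a::complex_inner set \<Rightarrow> 'a set \<Rightarrow> (nat \<Rightarrow> 'a) \<Rightarrow> (nat \<Rightarrow> 'a) \<Rightarrow> bool"
  where "oblique_dual_pair W1 W2 F G \<longleftrightarrow>
    oblique_dual_frame W1 W2 F G \<and> oblique_dual_frame W2 W1 G F"


section \<open>Synthesis and analysis are adjoint\<close>

context complex_inner
begin

lemma cinner_zero_left [simp]: "cinner 0 y = 0"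
  using cinner_add_left[of 0 0 y] by simp

lemma cinner_zero_right [simp]: "cinner x 0 = 0"
  by (subst cinner_commute) simp

lemma cinner_add_right: "cinner x (y + z) = cinner x y + cinner x z"
  using cinner_add_left[of y z x]
  by (simp add: cinner_commute[of x "y + z"] cinner_commute[of x y] cinner_commute[of x z])

lemma cinner_scaleC_right: "cinner x (a *\<^sub>C y) = cnj a * cinner x y"
  using cinner_scaleC_left[of a y x]
  by (simp add: cinner_commute[of x "a *\<^sub>C y"] cinner_commute[of x y])

lemma cinner_self: "cinner x x = complex_of_real ((norm x)\<^sup>2)"
proof -
  have "Im (cinner x x) = 0"
    using arg_cong[OF cinner_commute[of x x], of Im] by simp
  moreover have "Re (cinner x x) = (norm x)\<^sup>2"
    using norm_ge_zero[of x] by (simp add: norm_eq_sqrt_cinner)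
  ultimately show ?thesis
    by (simp add: complex_eq_iff)
qed

lemma cmod_cinner_le: "cmod (cinner x y) \<le> norm x * norm y"
proof (cases "y = 0")
  case False
  define a t where "a = cinner x y" and "t = - a / complex_of_real ((norm y)\<^sup>2)"
  have ny: "norm y > 0"
    using False by simp
  have yx: "cinner y x = cnj a"
    unfolding a_def by (rule cinner_commute)
  have "cinner (x + t *\<^sub>C y) (x + t *\<^sub>C y) =
      complex_of_real ((norm x)\<^sup>2) + cnj t * a + t * cnj a
        + t * cnj t * complex_of_real ((norm y)\<^sup>2)"
    by (simp add: cinner_add_left cinner_add_right cinner_scaleC_left cinner_scaleC_right
        cinner_self[of x] cinner_self[of y] yx algebra_simps flip: a_def)
  also have "\<dots> = complex_of_real ((norm x)\<^sup>2) - a * cnj a / complex_of_real ((norm y)\<^sup>2)"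
    using ny by (simp add: t_def field_simps power2_eq_square)
  also have "\<dots> = complex_of_real ((norm x)\<^sup>2 - (cmod a)\<^sup>2 / (norm y)\<^sup>2)"
    by (simp add: complex_norm_square[symmetric])
  finally have "(norm (x + t *\<^sub>C y))\<^sup>2 = (norm x)\<^sup>2 - (cmod a)\<^sup>2 / (norm y)\<^sup>2"
    unfolding cinner_self of_real_eq_iff .
  then have "(cmod a)\<^sup>2 / (norm y)\<^sup>2 \<le> (norm x)\<^sup>2"
    by (metis diff_ge_0_iff_ge zero_le_power2)
  then have "(cmod a)\<^sup>2 \<le> (norm x * norm y)\<^sup>2"
    using ny by (simp add: field_simps)
  then show ?thesis
    unfolding a_def by (rule power2_le_imp_le) simp
qed simp

end

lemma bounded_linear_cinner_left: "bounded_linear (\<lambda>x::'a::complex_inner. cinner x h)"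
  by (rule bounded_linear_intro[where K = "norm h"])
    (auto simp: cinner_add_left cinner_scaleC_left cmod_cinner_le
      simp flip: scaleC_of_real[where 'a = 'a] scaleR_conv_of_real)

lemma analysis_in_ell2: "bessel_in UNIV F \<Longrightarrow> analysis F h \<in> ell2"
  by (auto simp: bessel_in_def ell2_def analysis_def)

lemma synthesis_summable:
  fixes F :: "nat \<Rightarrow> 'a::chilbert_space"
  assumes F: "bessel_in UNIV F" and c: "c \<in> ell2"
  shows "summable (\<lambda>n. c n *\<^sub>C F n)"
proof -
  obtain B where B: "B > 0"
    and sm: "\<And>h. summable (\<lambda>n. (cmod (cinner h (F n)))\<^sup>2)"
    and le: "\<And>h. (\<Sum>n. (cmod (cinner h (F n)))\<^sup>2) \<le> B * (norm h)\<^sup>2"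
    using F unfolding bessel_in_def by auto
  have bnd: "(norm (\<Sum>n\<in>N. c n *\<^sub>C F n))\<^sup>2 \<le> B * (\<Sum>n\<in>N. (cmod (c n))\<^sup>2)"
    if N: "finite N" for N
  proof -
    define S where "S = (\<Sum>n\<in>N. c n *\<^sub>C F n)"
    define L where "L = (\<Sum>n\<in>N. (cmod (c n))\<^sup>2)"
    have "complex_of_real ((norm S)\<^sup>2) = cinner S S"
      by (simp add: cinner_self)
    also have "\<dots> = (\<Sum>n\<in>N. cinner (c n *\<^sub>C F n) S)"
      by (subst (1) S_def)
        (rule linear_sum[OF bounded_linear.linear[OF bounded_linear_cinner_left]])
    also have "\<dots> = (\<Sum>n\<in>N. c n * cinner (F n) S)"
      by (simp add: cinner_scaleC_left)
    finally have "(norm S)\<^sup>2 = cmod (\<Sum>n\<in>N. c n * cinner (F n) S)"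
      using norm_of_real[of "(norm S)\<^sup>2", where 'a = complex] by simp
    also have "\<dots> \<le> (\<Sum>n\<in>N. \<bar>cmod (c n)\<bar> * \<bar>cmod (cinner S (F n))\<bar>)"
    proof (rule sum_norm_le)
      fix n
      have "cmod (cinner (F n) S) = cmod (cinner S (F n))"
        by (metis cinner_commute complex_mod_cnj)
      then show "cmod (c n * cinner (F n) S) \<le> \<bar>cmod (c n)\<bar> * \<bar>cmod (cinner S (F n))\<bar>"
        by (simp add: norm_mult)
    qed
    also have "\<dots> \<le> L2_set (\<lambda>n. cmod (c n)) N * L2_set (\<lambda>n. cmod (cinner S (F n))) N"
      by (rule L2_set_mult_ineq)
    finally have "(norm S)\<^sup>2 \<le> sqrt (L * (\<Sum>n\<in>N. (cmod (cinner S (F n)))\<^sup>2))"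
      by (simp add: L2_set_def L_def real_sqrt_mult)
    then have "((norm S)\<^sup>2)\<^sup>2 \<le> (sqrt (L * (\<Sum>n\<in>N. (cmod (cinner S (F n)))\<^sup>2)))\<^sup>2"
      by (rule power_mono) simp
    then have "((norm S)\<^sup>2)\<^sup>2 \<le> L * (\<Sum>n\<in>N. (cmod (cinner S (F n)))\<^sup>2)"
      by (simp add: L_def sum_nonneg)
    also have "\<dots> \<le> L * (B * (norm S)\<^sup>2)"
      by (intro mult_left_mono order.trans[OF sum_le_suminf[OF sm N] le])
        (simp_all add: L_def sum_nonneg)
    finally have *: "(norm S)\<^sup>2 * (norm S)\<^sup>2 \<le> (B * L) * (norm S)\<^sup>2"
      by (simp add: power2_eq_square ac_simps)
    have "(norm S)\<^sup>2 \<le> B * L"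
    proof (cases "S = 0")
      case True
      then show ?thesis
        using B by (simp add: L_def sum_nonneg)
    next
      case False
      then have "(norm S)\<^sup>2 > 0"
        by simp
      then show ?thesis
        using * mult_right_le_imp_le by blast
    qed
    then show ?thesis
      by (simp add: S_def L_def)
  qed
  show ?thesis
    unfolding summable_Cauchy
  proof (intro allI impI)
    fix e :: real
    assume e: "e > 0"
    from c have "summable (\<lambda>n. (cmod (c n))\<^sup>2)"
      by (simp add: ell2_def)
    moreover have "e\<^sup>2 / B > 0"
      using e B by simp
    ultimately obtain K where K: "\<And>m n. m \<ge> K \<Longrightarrow> norm (\<Sum>k=m..<n. (cmod (c k))\<^sup>2) < e\<^sup>2 / B"
      unfolding summable_Cauchy by blast
    have "norm (\<Sum>k=m..<n. c k *\<^sub>C F k) < e" if "m \<ge> K" for m n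
    proof -
      have "(\<Sum>k=m..<n. (cmod (c k))\<^sup>2) < e\<^sup>2 / B"
        using K[OF that, of n] by simp
      then have "B * (\<Sum>k=m..<n. (cmod (c k))\<^sup>2) < e\<^sup>2"
        using B by (simp add: field_simps)
      then have "(norm (\<Sum>k=m..<n. c k *\<^sub>C F k))\<^sup>2 < e\<^sup>2"
        using bnd[of "{m..<n}"] by simp
      then show ?thesis
        using e by (meson less_imp_le power_less_imp_less_base)
    qed
    then show "\<exists>N. \<forall>m\<ge>N. \<forall>n. norm (\<Sum>k=m..<n. c k *\<^sub>C F k) < e"
      by blast
  qed
qed

lemma synthesis_analysis_adjoint:
  fixes F :: "nat \<Rightarrow> 'a::chilbert_space"
  assumes "bessel_in UNIV F" and "c \<in> ell2"
  shows "(\<lambda>n. c n * cnj (analysis F h n)) sums cinner (synthesis F c) h"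
proof -
  have "(\<lambda>n. c n *\<^sub>C F n) sums synthesis F c"
    using synthesis_summable[OF assms] by (simp add: synthesis_def summable_sums)
  from bounded_linear.sums[OF bounded_linear_cinner_left this, of h]
  have "(\<lambda>n. c n * cinner (F n) h) sums cinner (synthesis F c) h"
    by (simp add: cinner_scaleC_left)
  moreover have "cnj (cinner h (F n)) = cinner (F n) h" for n
    by (rule cinner_commute[symmetric])
  ultimately show ?thesis
    by (simp add: analysis_def)
qed

end

theory Submission
  imports Defs
begin

text \<open>
  If \<open>T\<^sub>F T\<^sub>G\<^sup>*\<close> is the projection onto \<open>W\<^sub>1\<close> along the orthogonal complement of \<open>W\<^sub>2\<close>, for
  Bessel sequences \<open>F\<close> in \<open>W\<^sub>1\<close> and \<open>G\<close> in \<open>W\<^sub>2\<close>, then its adjoint \<open>T\<^sub>G T\<^sub>F\<^sup>*\<close> is the projection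
  onto \<open>W\<^sub>2\<close> along the orthogonal complement of \<open>W\<^sub>1\<close>, and the two reproducing identities yield
  the lower frame bounds. So it suffices to identify one mixed operator per pair. With \<open>P\<close> the
  oblique pseudoinverse of \<open>M\<close>, these operators are \<open>P M = \<pi>\<^bsub>W,ker M\<^esub>\<close> and
  \<open>\<pi>\<^bsub>ran M,V\<^esub> M P = M P = \<pi>\<^bsub>ran M,V\<^esub>\<close>. Boundedness of the projections and of \<open>P\<close> comes from the
  closed graph theorem.
\<close>

section \<open>Linear operators with an adjoint\<close>

lemma cinner_minus_left: "cinner (- x) y = - cinner (x::'a::complex_inner) y"
  using cinner_add_left[of x "- x" y] by (simp add: add_eq_0_iff)

lemma cinner_diff_left: "cinner (x - y) z = cinner (x::'a::complex_inner) z - cinner y z"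
  using cinner_add_left[of x "- y" z] by (simp add: cinner_minus_left)

lemma cinner_diff_right: "cinner x (y - z) = cinner (x::'a::complex_inner) y - cinner x z"
  using cinner_diff_left[of y z x]
  by (simp add: cinner_commute[of x "y - z"] cinner_commute[of x y] cinner_commute[of x z])

lemma cinner_eq_zero_commute: "cinner x y = 0 \<longleftrightarrow> cinner y (x::'a::complex_inner) = 0"
  by (metis cinner_commute complex_cnj_zero)

lemma cinner_self_eq_zero [simp]: "cinner x x = 0 \<longleftrightarrow> (x::'a::complex_inner) = 0"
  by (simp add: cinner_self)

lemma cinner_eqI_left:
  fixes x y :: "'a::complex_inner"
  assumes "\<And>z. cinner x z = cinner y z"
  shows "x = y"
  using assms[of "x - y"] cinner_self_eq_zero[of "x - y"] by (simp add: cinner_diff_left)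

lemma cinner_eqI_right:
  fixes x y :: "'a::complex_inner"
  assumes "\<And>z. cinner z x = cinner z y"
  shows "x = y"
  by (rule cinner_eqI_left) (metis assms cinner_commute)

lemma tendsto_cinner_left:
  "(f \<longlongrightarrow> x) F \<Longrightarrow> ((\<lambda>t. cinner (f t) y) \<longlongrightarrow> cinner (x::'a::complex_inner) y) F"
  by (rule bounded_linear.tendsto[OF bounded_linear_cinner_left])

definition clinear :: "('a::complex_vector \<Rightarrow> 'b::complex_vector) \<Rightarrow> bool"
  where "clinear T \<longleftrightarrow> (\<forall>x y. T (x + y) = T x + T y) \<and> (\<forall>a x. T (a *\<^sub>C x) = a *\<^sub>C T x)"

text \<open>A relation instead of \<open>cadjoint\<close>, so that a concrete candidate for the
  adjoint can be used before the definite description is known to be meaningful.\<close>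

definition adjoint_pair ::
  "('a::complex_inner \<Rightarrow> 'b::complex_inner) \<Rightarrow> ('b \<Rightarrow> 'a) \<Rightarrow> bool"
  where "adjoint_pair T S \<longleftrightarrow> (\<forall>x y. cinner (T x) y = cinner x (S y))"

lemma clinear_scaleC: "clinear T \<Longrightarrow> T (a *\<^sub>C x) = a *\<^sub>C T x"
  by (simp add: clinear_def)

lemma clinear_imp_linear:
  fixes T :: "'a::complex_inner \<Rightarrow> 'b::complex_inner"
  assumes "clinear T"
  shows "linear T"
  using assms by (intro linearI) (simp_all add: clinear_def flip: scaleC_of_real)

lemma adjoint_pair_sym: "adjoint_pair T S \<Longrightarrow> adjoint_pair S T"
  unfolding adjoint_pair_def by (metis cinner_commute)

text \<open>Testing against an arbitrary vector moves \<open>T\<close> away and leaves only the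
  linear left slot of \<open>cinner\<close>.\<close>

lemma adjoint_pair_clinear:
  assumes "adjoint_pair T S"
  shows "clinear T"
  unfolding clinear_def
proof (intro conjI allI)
  fix x y a
  show "T (x + y) = T x + T y"
    by (rule cinner_eqI_left) (use assms in \<open>simp add: adjoint_pair_def cinner_add_left\<close>)
  show "T (a *\<^sub>C x) = a *\<^sub>C T x"
    by (rule cinner_eqI_left) (use assms in \<open>simp add: adjoint_pair_def cinner_scaleC_left\<close>)
qed

lemma adjoint_pair_cadjoint_eq:
  assumes "adjoint_pair T S"
  shows "cadjoint T = S"
  unfolding cadjoint_def
proof (rule the_equality)
  show "\<forall>x y. cinner (T x) y = cinner x (S y)"
    using assms by (simp add: adjoint_pair_def)
  fix S'
  assume "\<forall>x y. cinner (T x) y = cinner x (S' y)"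
  then have "cinner x (S' y) = cinner x (S y)" for x y
    using assms by (simp add: adjoint_pair_def)
  then show "S' = S"
    by (rule ext[OF cinner_eqI_right])
qed

text \<open>
  By Baire, some sublevel set of \<open>norm \<circ> T\<close> is dense in a ball, so every \<open>x\<close> is approximated up
  to \<open>norm x / 2\<close> by some \<open>z\<close> with \<open>norm (T z) \<le> K * norm x\<close>; iterating on the error writes \<open>x\<close>
  as a series whose image under \<open>T\<close> converges absolutely.
\<close>

theorem closed_graph:
  fixes T :: "'a::banach \<Rightarrow> 'b::banach"
  assumes lin: "linear T"
    and graph: "\<And>u x y. u \<longlonglongrightarrow> x \<Longrightarrow> (\<lambda>n. T (u n)) \<longlonglongrightarrow> y \<Longrightarrow> T x = y"
  shows "bounded_linear T"
proof -
  define A where "A n = closure {x. norm (T x) \<le> real n}" for n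
  have "(\<Union>n. A n) = UNIV"
  proof -
    have "x \<in> A (nat \<lceil>norm (T x)\<rceil>)" for x
      unfolding A_def by (rule subsetD[OF closure_subset]) (simp add: of_nat_ceiling)
    then show ?thesis
      by blast
  qed
  then have "euclidean interior_of (\<Union>(range A)) \<noteq> {}"
    by simp
  then obtain n where "interior (A n) \<noteq> {}"
    using Baire_category_alt[of "euclidean :: 'a topology" "range A"]
      completely_metrizable_space_euclidean[where 'a = 'a]
    by (auto simp: A_def)
  then obtain a r where r: "r > 0" and "ball a r \<subseteq> A n"
    by (auto simp: mem_interior)
  then have near: "\<exists>u. norm (T u) \<le> real n \<and> norm (u - x) < d"
    if "norm (x - a) < r" "d > 0" for x d
    using that unfolding A_def
    by (metis (mono_tags, lifting) closure_approachable dist_norm mem_Collect_eq mem_ball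
        norm_minus_commute subset_iff)
  \<comment> \<open>The factor 4 is 2 from the difference \<open>u - v\<close> of two vectors whose
    images have norm at most \<open>n\<close>, times 2 from
    \<open>1 / t = 2 * norm x / r\<close>.\<close>
  define K where "K = 4 * real n / r"
  have K: "K \<ge> 0"
    using r by (simp add: K_def)
  have "\<exists>z. norm (T z) \<le> K * norm x \<and> norm (x - z) \<le> norm x / 2" for x
  proof (cases "x = 0")
    case True
    then show ?thesis
      using linear_0[OF lin] by (intro exI[of _ 0]) simp
  next
    case False
    \<comment> \<open>Scaling by \<open>t\<close> keeps \<open>a + t x\<close> inside the ball.
      Approximating both it and the centre \<open>a\<close> to within \<open>r / 8\<close>
      approximates \<open>t x\<close> by \<open>u - v\<close> to within \<open>r / 4\<close>, which
      is half of \<open>t * norm x\<close>.\<close>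
    define t where "t = r / (2 * norm x)"
    have t: "t > 0" "t * norm x = r / 2"
      using r False by (auto simp: t_def)
    obtain u where u: "norm (T u) \<le> real n" "norm (u - (a + t *\<^sub>R x)) < r / 8"
      using near[of "a + t *\<^sub>R x" "r / 8"] r t by auto
    obtain v where v: "norm (T v) \<le> real n" "norm (v - a) < r / 8"
      using near[of a "r / 8"] r by auto
    define z where "z = inverse t *\<^sub>R (u - v)"
    have "norm (T z) = inverse t * norm (T u - T v)"
      using t by (simp add: z_def linear_scale[OF lin] linear_diff[OF lin])
    also have "\<dots> \<le> inverse t * (2 * real n)"
      using t u v norm_triangle_ineq4[of "T u" "T v"] by (intro mult_left_mono) auto
    also have "\<dots> = K * norm x"
      using r False by (simp add: t_def K_def field_simps)
    finally have 1: "norm (T z) \<le> K * norm x" .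
    have "x - z = inverse t *\<^sub>R ((v - a) - (u - (a + t *\<^sub>R x)))"
      using t by (simp add: z_def algebra_simps)
    then have "norm (x - z) = inverse t * norm ((v - a) - (u - (a + t *\<^sub>R x)))"
      using t by simp
    also have "\<dots> \<le> inverse t * (r / 4)"
      using t u v norm_triangle_ineq4[of "v - a" "u - (a + t *\<^sub>R x)"]
      by (intro mult_left_mono) auto
    also have "\<dots> = norm x / 2"
      using r False by (simp add: t_def field_simps)
    finally show ?thesis
      using 1 by blast
  qed
  then obtain g where g1: "\<And>x. norm (T (g x)) \<le> K * norm x"
    and g2: "\<And>x. norm (x - g x) \<le> norm x / 2"
    by metis
  have "norm (T x) \<le> norm x * (2 * K)" for x
  proof -
    \<comment> \<open>\<open>e k\<close> is the error left after \<open>k\<close> corrections; it at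
      least halves in norm each time, and \<open>x - e k\<close> is the sum of the first
      \<open>k\<close> corrections.\<close>
    define e where "e = rec_nat x (\<lambda>_ w. w - g w)"
    have e0: "e 0 = x" and eS: "e (Suc k) = e k - g (e k)" for k
      by (simp_all add: e_def)
    have e_le: "norm (e k) \<le> norm x * (1 / 2) ^ k" for k
    proof (induction k)
      case (Suc k)
      then show ?case
        using g2[of "e k"] by (simp add: eS)
    qed (simp add: e0)
    have e_lim: "e \<longlonglongrightarrow> 0"
    proof (rule Lim_null_comparison)
      show "\<forall>\<^sub>F k in sequentially. norm (e k) \<le> norm x * (1 / 2) ^ k"
        using e_le by simp
      show "(\<lambda>k. norm x * (1 / 2) ^ k) \<longlonglongrightarrow> 0"
        by (intro tendsto_mult_right_zero LIMSEQ_power_zero) simp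
    qed
    have Tg_le: "norm (T (g (e k))) \<le> K * norm x * (1 / 2) ^ k" for k
      using order.trans[OF g1 mult_left_mono[OF e_le K]] by (simp add: mult.assoc)
    have geo: "(\<lambda>k. K * norm x * (1 / 2) ^ k) sums (K * norm x * 2)"
      using sums_mult[OF geometric_sums[of "1 / 2 :: real"], of "K * norm x"] by simp
    have sm: "summable (\<lambda>k. norm (T (g (e k))))"
      using Tg_le by (intro summable_comparison_test'[OF sums_summable[OF geo]]) simp
    define y where "y = (\<Sum>k. T (g (e k)))"
    have "T (x - e k) = (\<Sum>j<k. T (g (e j)))" for k
      by (induction k)
        (simp_all add: e0 eS linear_0[OF lin] linear_diff[OF lin] linear_add[OF lin] algebra_simps)
    then have "(\<lambda>k. T (x - e k)) \<longlonglongrightarrow> y"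
      using summable_LIMSEQ[OF summable_norm_cancel[OF sm]] by (simp add: y_def)
    moreover have "(\<lambda>k. x - e k) \<longlonglongrightarrow> x"
      using tendsto_diff[OF tendsto_const e_lim, of x] by simp
    ultimately have "T x = y"
      by (rule graph[rotated])
    also have "norm y \<le> (\<Sum>k. norm (T (g (e k))))"
      unfolding y_def by (rule summable_norm[OF sm])
    also have "\<dots> \<le> K * norm x * 2"
      using suminf_le[OF Tg_le sm sums_summable[OF geo]] sums_unique[OF geo] by simp
    finally show ?thesis
      by (simp add: ac_simps)
  qed
  then show ?thesis
    using lin by (intro bounded_linear.intro bounded_linear_axioms.intro) auto
qed

text \<open>The Hellinger--Toeplitz theorem: an everywhere defined adjoint makes the graph of \<open>T\<close> closed.\<close>

lemma adjoint_pair_bounded_linear: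
  fixes T :: "'a::chilbert_space \<Rightarrow> 'b::chilbert_space"
  assumes adj: "adjoint_pair T S"
  shows "bounded_linear T"
proof (rule closed_graph)
  show "linear T"
    by (rule clinear_imp_linear[OF adjoint_pair_clinear[OF adj]])
  fix u x y
  assume u: "u \<longlonglongrightarrow> x" and Tu: "(\<lambda>n. T (u n)) \<longlonglongrightarrow> y"
  show "T x = y"
  proof (rule cinner_eqI_left)
    fix z
    have "(\<lambda>n. cinner (T (u n)) z) \<longlonglongrightarrow> cinner (T x) z"
      using tendsto_cinner_left[OF u] adj by (simp add: adjoint_pair_def)
    then show "cinner (T x) z = cinner y z"
      using LIMSEQ_unique tendsto_cinner_left[OF Tu] by blast
  qed
qed

section \<open>Riesz representation and existence of adjoints\<close>

lemma parallelogram: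
  fixes x y :: "'a::complex_inner"
  shows "(norm (x + y))\<^sup>2 + (norm (x - y))\<^sup>2 = 2 * (norm x)\<^sup>2 + 2 * (norm y)\<^sup>2"
proof -
  have "complex_of_real ((norm (x + y))\<^sup>2 + (norm (x - y))\<^sup>2) =
      complex_of_real (2 * (norm x)\<^sup>2 + 2 * (norm y)\<^sup>2)"
    unfolding of_real_add of_real_mult cinner_self[symmetric]
    by (simp add: cinner_add_left cinner_add_right cinner_diff_left cinner_diff_right)
  then show ?thesis
    using of_real_eq_iff by blast
qed

text \<open>The chosen \<open>t\<close> minimises the norm of \<open>x + t z\<close>, with minimal
  square \<open>|x|^2 - |<x,z>|^2 / |z|^2\<close>; this can only be at least \<open>|x|^2\<close> if
  the inner product vanishes.\<close>

lemma minimal_norm_orthogonal: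
  fixes x z :: "'a::complex_inner"
  assumes "\<And>t. norm x \<le> norm (x + t *\<^sub>C z)"
  shows "cinner z x = 0"
proof (cases "z = 0")
  case False
  define a t where "a = cinner x z" and "t = - a / complex_of_real ((norm z)\<^sup>2)"
  have nz: "norm z > 0"
    using False by simp
  have zx: "cinner z x = cnj a"
    unfolding a_def by (rule cinner_commute)
  have "cinner (x + t *\<^sub>C z) (x + t *\<^sub>C z) =
      complex_of_real ((norm x)\<^sup>2) + cnj t * a + t * cnj a
        + t * cnj t * complex_of_real ((norm z)\<^sup>2)"
    by (simp add: cinner_add_left cinner_add_right cinner_scaleC_left cinner_scaleC_right
        cinner_self[of x] cinner_self[of z] zx algebra_simps flip: a_def)
  also have "\<dots> = complex_of_real ((norm x)\<^sup>2) - a * cnj a / complex_of_real ((norm z)\<^sup>2)"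
    using nz by (simp add: t_def field_simps power2_eq_square)
  also have "\<dots> = complex_of_real ((norm x)\<^sup>2 - (cmod a)\<^sup>2 / (norm z)\<^sup>2)"
    by (simp add: complex_norm_square[symmetric])
  finally have "(norm (x + t *\<^sub>C z))\<^sup>2 = (norm x)\<^sup>2 - (cmod a)\<^sup>2 / (norm z)\<^sup>2"
    unfolding cinner_self of_real_eq_iff .
  moreover have "(norm x)\<^sup>2 \<le> (norm (x + t *\<^sub>C z))\<^sup>2"
    by (intro power_mono assms) simp
  ultimately have "(cmod a)\<^sup>2 / (norm z)\<^sup>2 \<le> 0"
    by simp
  then show ?thesis
    using nz by (simp add: zx divide_le_0_iff)
qed simp

text \<open>The representing vector is a multiple of the element of least norm in \<open>{x. f x = 1}\<close>.\<close>

lemma riesz_representation: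
  fixes f :: "'a::chilbert_space \<Rightarrow> complex"
  assumes clin: "clinear f" and bl: "bounded_linear f"
  shows "\<exists>y. \<forall>x. f x = cinner x y"
proof (cases "\<exists>x. f x \<noteq> 0")
  case False
  then show ?thesis
    by (intro exI[of _ 0]) simp
next
  case True
  then obtain w where w: "f w \<noteq> 0"
    by blast
  interpret f: bounded_linear f
    by (rule bl)
  have f_scaleC: "f (a *\<^sub>C x) = a * f x" for a x
    using clinear_scaleC[OF clin] by (simp add: scaleC_complex_def)
  define C where "C = {x. f x = 1}"
  define d where "d = (INF x\<in>C. (norm x)\<^sup>2)"
  have "inverse (f w) *\<^sub>C w \<in> C"
    using w by (simp add: C_def f_scaleC)
  then have ne: "C \<noteq> {}"
    by blast
  have bdd: "bdd_below ((\<lambda>x. (norm x)\<^sup>2) ` C)"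
    by (rule bdd_belowI[of _ 0]) auto
  have d_le: "d \<le> (norm x)\<^sup>2" if "x \<in> C" for x
    unfolding d_def using bdd that by (rule cINF_lower)
  have "\<exists>x\<in>C. (norm x)\<^sup>2 < d + 1 / real (Suc n)" for n
  proof -
    have "(INF x\<in>C. (norm x)\<^sup>2) < d + 1 / real (Suc n)"
      by (simp add: d_def)
    then show ?thesis
      using cINF_less_iff[OF ne bdd] by blast
  qed
  then obtain u where "\<And>n. u n \<in> C" and u: "\<And>n. (norm (u n))\<^sup>2 < d + 1 / real (Suc n)"
    by metis
  then have uC: "f (u n) = 1" for n
    by (simp add: C_def)
  have diff: "(norm (u n - u k))\<^sup>2 \<le> 2 / real (Suc n) + 2 / real (Suc k)" for n k
  proof -
    \<comment> \<open>The midpoint stays in the affine set \<open>C\<close>, which bounds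
      \<open>u n + u k\<close> from below; the parallelogram law then bounds
      \<open>u n - u k\<close> from above.\<close>
    have "(1 / 2) *\<^sub>R (u n + u k) \<in> C"
      by (simp add: C_def f.scaleR f.add uC scaleR_conv_of_real)
    then have "d \<le> (norm ((1 / 2) *\<^sub>R (u n + u k)))\<^sup>2"
      by (rule d_le)
    then have "4 * d \<le> (norm (u n + u k))\<^sup>2"
      by (simp add: power_divide)
    then show ?thesis
      using parallelogram[of "u n" "u k"] u[of n] u[of k] by simp
  qed
  have "Cauchy u"
  proof (rule CauchyI)
    fix e :: real
    assume e: "e > 0"
    then obtain N where N: "inverse (real (Suc N)) < e\<^sup>2 / 4"
      using reals_Archimedean[of "e\<^sup>2 / 4"] by auto
    have "norm (u n - u k) < e" if "n \<ge> N" "k \<ge> N" for n k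
    proof -
      have "1 / real (Suc n) \<le> inverse (real (Suc N))" "1 / real (Suc k) \<le> inverse (real (Suc N))"
        using that by (simp_all add: inverse_eq_divide frac_le)
      then have "(norm (u n - u k))\<^sup>2 < e\<^sup>2"
        using diff[of n k] N by simp
      then show ?thesis
        using e by (meson less_imp_le power_less_imp_less_base)
    qed
    then show "\<exists>N. \<forall>m\<ge>N. \<forall>n\<ge>N. norm (u m - u n) < e"
      by blast
  qed
  then obtain p where p: "u \<longlonglongrightarrow> p"
    using Cauchy_convergent convergent_def by blast
  have fp: "f p = 1"
    using f.tendsto[OF p] uC by (simp add: LIMSEQ_const_iff)
  have "(norm p)\<^sup>2 \<le> d"
  proof (rule LIMSEQ_le)
    show "(\<lambda>n. (norm (u n))\<^sup>2) \<longlonglongrightarrow> (norm p)\<^sup>2"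
      by (intro tendsto_intros p)
    show "(\<lambda>n. d + 1 / real (Suc n)) \<longlonglongrightarrow> d"
      using tendsto_add[OF tendsto_const LIMSEQ_inverse_real_of_nat, of d]
      by (simp add: inverse_eq_divide)
    show "\<exists>N. \<forall>n\<ge>N. (norm (u n))\<^sup>2 \<le> d + 1 / real (Suc n)"
      using u by (meson less_imp_le)
  qed
  have ortho: "cinner z p = 0" if "f z = 0" for z
  proof (rule minimal_norm_orthogonal)
    fix t
    have "p + t *\<^sub>C z \<in> C"
      using that by (simp add: C_def f.add f_scaleC fp)
    then have "(norm p)\<^sup>2 \<le> (norm (p + t *\<^sub>C z))\<^sup>2"
      using d_le \<open>(norm p)\<^sup>2 \<le> d\<close> by (meson order.trans)
    then show "norm p \<le> norm (p + t *\<^sub>C z)"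
      by (rule power2_le_imp_le) simp
  qed
  have np: "cinner p p \<noteq> 0"
    using fp by auto
  \<comment> \<open>\<open>x - f x p\<close> lies in the kernel of \<open>f\<close>, hence is
    orthogonal to \<open>p\<close>. The conjugate in the scalar compensates for the conjugate-linear
    right slot.\<close>
  have "f x = cinner x (inverse (cnj (cinner p p)) *\<^sub>C p)" for x
  proof -
    have "cinner (x - f x *\<^sub>C p) p = 0"
      by (rule ortho) (simp add: f.diff f_scaleC fp)
    then show ?thesis
      using np by (simp add: cinner_diff_left cinner_scaleC_left cinner_scaleC_right)
  qed
  then show ?thesis
    by blast
qed

text \<open>For each fixed \<open>y\<close>, Riesz represents the functional sending
  \<open>x\<close> to \<open>cinner (T x) y\<close>; choice collects the representing vectors into
  an adjoint, and uniqueness identifies it with \<open>cadjoint T\<close>.\<close>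

lemma adjoint_pair_cadjoint:
  fixes T :: "'a::chilbert_space \<Rightarrow> 'b::chilbert_space"
  assumes clin: "clinear T" and bl: "bounded_linear T"
  shows "adjoint_pair T (cadjoint T)"
proof -
  have "\<exists>z. \<forall>x. cinner (T x) y = cinner x z" for y
  proof (rule riesz_representation)
    show "clinear (\<lambda>x. cinner (T x) y)"
      using clin by (simp add: clinear_def cinner_add_left cinner_scaleC_left scaleC_complex_def)
    show "bounded_linear (\<lambda>x. cinner (T x) y)"
      using bounded_linear_compose[OF bounded_linear_cinner_left bl] .
  qed
  then obtain S where "adjoint_pair T S"
    unfolding adjoint_pair_def by metis
  then show ?thesis
    using adjoint_pair_cadjoint_eq by blast
qed


section \<open>Closed subspaces and oblique projections\<close>

lemma scaleC_minus_one: "(- 1) *\<^sub>C x = - (x::'a::complex_vector)"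
  using scaleC_of_real[of "- 1" x] by simp

lemma closed_csubspace_add: "closed_csubspace X \<Longrightarrow> x \<in> X \<Longrightarrow> y \<in> X \<Longrightarrow> x + y \<in> X"
  and closed_csubspace_scaleC: "closed_csubspace X \<Longrightarrow> x \<in> X \<Longrightarrow> a *\<^sub>C x \<in> X"
  and closed_csubspace_zero: "closed_csubspace X \<Longrightarrow> 0 \<in> X"
  and closed_csubspace_closed: "closed_csubspace X \<Longrightarrow> closed X"
  by (simp_all add: closed_csubspace_def)

lemma closed_csubspace_diff:
  assumes "closed_csubspace X" "x \<in> X" "y \<in> X"
  shows "x - y \<in> X"
  using closed_csubspace_add[OF assms(1,2) closed_csubspace_scaleC[OF assms(1,3), of "- 1"]]
  by (simp add: scaleC_minus_one)

lemma closed_csubspace_ocomp: "closed_csubspace (ocomp S)"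
proof -
  have "closed (ocomp S)"
    unfolding closed_sequential_limits
  proof (intro allI impI, elim conjE)
    fix u x
    assume u: "\<forall>n. u n \<in> ocomp S" and lim: "u \<longlonglongrightarrow> x"
    have "cinner x y = 0" if "y \<in> S" for y
      using tendsto_cinner_left[OF lim, of y] u that by (simp add: ocomp_def LIMSEQ_const_iff)
    then show "x \<in> ocomp S"
      by (simp add: ocomp_def)
  qed
  then show ?thesis
    by (auto simp: closed_csubspace_def ocomp_def cinner_add_left cinner_scaleC_left)
qed

lemma ocomp_ocomp_superset: "S \<subseteq> ocomp (ocomp S)"
  unfolding ocomp_def using cinner_eq_zero_commute by blast

lemma ocomp_antimono: "S \<subseteq> T \<Longrightarrow> ocomp T \<subseteq> ocomp S"
  unfolding ocomp_def by blast

text \<open>Exhibits the kernel as an orthogonal complement, from which its closedness and its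
  biorthogonality follow.\<close>

lemma adjoint_pair_ker:
  assumes adj: "adjoint_pair T S"
  shows "ker T = ocomp (range S)"
proof (intro equalityI subsetI)
  show "x \<in> ocomp (range S)" if "x \<in> ker T" for x
    using adj that by (auto simp: ker_def ocomp_def adjoint_pair_def) (metis cinner_zero_left)
  show "x \<in> ker T" if "x \<in> ocomp (range S)" for x
  proof -
    have "T x = 0"
      by (rule cinner_eqI_left) (use adj that in \<open>simp add: ocomp_def adjoint_pair_def\<close>)
    then show ?thesis
      by (simp add: ker_def)
  qed
qed

text \<open>The kernel is a complement, and a triple complement equals the single one.\<close>

lemma adjoint_pair_ker_biorthogonal:
  assumes "adjoint_pair T S"
  shows "ocomp (ocomp (ker T)) = ker T"
  unfolding adjoint_pair_ker[OF assms]
  using ocomp_ocomp_superset[of "range S"] ocomp_ocomp_superset[of "ocomp (range S)"]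
    ocomp_antimono by blast

lemma adjoint_pair_closed_csubspace_ker: "adjoint_pair T S \<Longrightarrow> closed_csubspace (ker T)"
  by (simp add: adjoint_pair_ker closed_csubspace_ocomp)

lemma clinear_closed_csubspace_range:
  fixes T :: "'a::complex_inner \<Rightarrow> 'b::complex_inner"
  assumes "clinear T" and "closed (range T)"
  shows "closed_csubspace (range T)"
proof -
  have "T x + T y \<in> range T" "a *\<^sub>C T x \<in> range T" for x y a
    using assms(1) by (metis clinear_def rangeI)+
  moreover have "0 \<in> range T"
    using linear_0[OF clinear_imp_linear[OF assms(1)]] by (metis rangeI)
  ultimately show ?thesis
    using assms(2) by (auto simp: closed_csubspace_def)
qed

lemma sums_in_closed_csubspace:
  assumes X: "closed_csubspace X" and F: "range F \<subseteq> X" and s: "(\<lambda>n. c n *\<^sub>C F n) sums s"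
  shows "s \<in> X"
proof (rule closed_sequentially[OF closed_csubspace_closed[OF X]])
  show "(\<lambda>n. \<Sum>k<n. c k *\<^sub>C F k) \<longlonglongrightarrow> s"
    using s by (simp add: sums_def)
  show "(\<Sum>k<n. c k *\<^sub>C F k) \<in> X" for n
    using F by (induction n)
      (auto intro!: closed_csubspace_zero closed_csubspace_add closed_csubspace_scaleC X)
qed

text \<open>Serves four decompositions: \<open>W\<close> with \<open>ker M\<close> and
  \<open>range M\<close> with \<open>V\<close> in the theorem, and the two mutually adjoint ones
  behind a dual pair.\<close>

locale oblique_decomposition =
  fixes X Z :: "'a::chilbert_space set"
  assumes X: "closed_csubspace X" and Z: "closed_csubspace Z" and XZ: "direct_sum X Z"
begin

abbreviation "P \<equiv> oblique_proj X Z"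

lemma P_unique:
  assumes x: "x \<in> X" "h - x \<in> Z" and x': "x' \<in> X" "h - x' \<in> Z"
  shows "x' = x"
proof -
  have "x' - x \<in> X"
    by (rule closed_csubspace_diff[OF X x'(1) x(1)])
  moreover have "(h - x) - (h - x') \<in> Z"
    by (rule closed_csubspace_diff[OF Z x(2) x'(2)])
  ultimately have "x' - x \<in> X \<inter> Z"
    by simp
  then have "x' - x = 0"
    using XZ unfolding direct_sum_def by blast
  then show ?thesis
    by simp
qed

lemma P_eqI:
  assumes "x \<in> X" "h - x \<in> Z"
  shows "P h = x"
  unfolding oblique_proj_def
proof (rule the_equality)
  show "x \<in> X \<and> (\<exists>z\<in>Z. h = x + z)"
    using assms by (metis add.commute diff_add_cancel)
  fix x'
  assume "x' \<in> X \<and> (\<exists>z\<in>Z. h = x' + z)"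
  then show "x' = x"
    using P_unique[OF assms] by auto
qed

lemma P_in: "P h \<in> X" and diff_P_in: "h - P h \<in> Z"
proof -
  obtain x z where "x \<in> X" "z \<in> Z" "h = x + z"
    using XZ unfolding direct_sum_def by blast
  moreover from this have "P h = x"
    by (intro P_eqI) auto
  ultimately show "P h \<in> X" "h - P h \<in> Z"
    by auto
qed

lemma P_clinear: "clinear P"
  unfolding clinear_def
proof (intro conjI allI P_eqI)
  fix x y a
  show "P x + P y \<in> X" "a *\<^sub>C P x \<in> X"
    using P_in X by (auto intro: closed_csubspace_add closed_csubspace_scaleC)
  have "(x - P x) + (y - P y) \<in> Z"
    using diff_P_in Z by (intro closed_csubspace_add)
  then show "x + y - (P x + P y) \<in> Z"
    by (simp add: algebra_simps)
  have "a *\<^sub>C (x - P x) \<in> Z"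
    using diff_P_in Z by (intro closed_csubspace_scaleC)
  moreover have "a *\<^sub>C (x - P x) = a *\<^sub>C x - a *\<^sub>C P x"
    using scaleC_add_right[of a "x - P x" "P x"] by (simp add: algebra_simps)
  ultimately show "a *\<^sub>C x - a *\<^sub>C P x \<in> Z"
    by simp
qed

text \<open>The graph is closed because membership of \<open>P h\<close> in \<open>X\<close> and of
  \<open>h - P h\<close> in \<open>Z\<close> both survive limits.\<close>

lemma P_bounded_linear: "bounded_linear P"
proof (rule closed_graph)
  show "linear P"
    by (rule clinear_imp_linear[OF P_clinear])
  fix u x y
  assume u: "u \<longlonglongrightarrow> x" and Pu: "(\<lambda>n. P (u n)) \<longlonglongrightarrow> y"
  show "P x = y"
  proof (rule P_eqI)
    show "y \<in> X"
      by (rule closed_sequentially[OF closed_csubspace_closed[OF X] P_in Pu])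
    show "x - y \<in> Z"
      by (rule closed_sequentially[OF closed_csubspace_closed[OF Z] diff_P_in
            tendsto_diff[OF u Pu]])
  qed
qed

lemma P_adjoint: "adjoint_pair P (cadjoint P)"
  by (rule adjoint_pair_cadjoint[OF P_clinear P_bounded_linear])

lemma P_on_X: "x \<in> X \<Longrightarrow> P x = x"
  by (rule P_eqI) (auto intro: closed_csubspace_zero Z)

lemma P_on_Z: "z \<in> Z \<Longrightarrow> P z = 0"
  by (rule P_eqI) (auto intro: closed_csubspace_zero X)

lemma ker_P: "ker P = Z"
  unfolding ker_def using P_on_Z diff_P_in by (auto, metis diff_zero)

text \<open>\<open>Z\<close> is the kernel of \<open>P\<close>, which has an adjoint. This matches
  the double complements that arise when a dual pair is formed with \<open>ocomp Z\<close>.\<close>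

lemma biorthogonal_Z: "ocomp (ocomp Z) = Z"
  using adjoint_pair_ker_biorthogonal[OF P_adjoint] by (simp add: ker_P)

lemma cadjoint_P_in: "cadjoint P h \<in> ocomp Z"
  unfolding ocomp_def using adjoint_pair_sym[OF P_adjoint] P_on_Z
  by (simp add: adjoint_pair_def)

end


section \<open>Bessel sequences\<close>

lemma bessel_in_subset:
  assumes "bessel_in UNIV F" "closed_csubspace X" "range F \<subseteq> X"
  shows "bessel_in X F"
  using assms unfolding bessel_in_def by blast

lemma bessel_in_UNIV_iff:
  "bessel_in UNIV F \<longleftrightarrow> (\<exists>B>0. \<forall>h. summable (\<lambda>n. (cmod (cinner h (F n)))\<^sup>2) \<and>
    (\<Sum>n. (cmod (cinner h (F n)))\<^sup>2) \<le> B * (norm h)\<^sup>2)"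
  by (simp add: bessel_in_def closed_csubspace_def)

text \<open>The coefficients of \<open>h\<close> against \<open>T (F n)\<close> are those of
  \<open>S h\<close> against \<open>F n\<close>, and \<open>S\<close> is bounded.\<close>

lemma bessel_in_adjoint_pair:
  fixes T :: "'a::chilbert_space \<Rightarrow> 'b::chilbert_space"
  assumes F: "bessel_in UNIV F" and adj: "adjoint_pair T S"
  shows "bessel_in UNIV (\<lambda>n. T (F n))"
proof -
  obtain B where B: "B > 0"
    and sm: "\<And>h. summable (\<lambda>n. (cmod (cinner h (F n)))\<^sup>2)"
    and le: "\<And>h. (\<Sum>n. (cmod (cinner h (F n)))\<^sup>2) \<le> B * (norm h)\<^sup>2"
    using F unfolding bessel_in_UNIV_iff by blast
  obtain K where K: "K > 0" "\<And>h. norm (S h) \<le> norm h * K"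
    using bounded_linear.pos_bounded[OF adjoint_pair_bounded_linear[OF adjoint_pair_sym[OF adj]]]
    by blast
  have eq: "cinner h (T (F n)) = cinner (S h) (F n)" for h n
    using adjoint_pair_sym[OF adj] by (simp add: adjoint_pair_def)
  have "(\<Sum>n. (cmod (cinner h (T (F n))))\<^sup>2) \<le> (B * K\<^sup>2) * (norm h)\<^sup>2" for h
  proof -
    have "(\<Sum>n. (cmod (cinner h (T (F n))))\<^sup>2) \<le> B * (norm (S h))\<^sup>2"
      using le[of "S h"] by (simp add: eq)
    also have "\<dots> \<le> B * (norm h * K)\<^sup>2"
      using B K by (intro mult_left_mono power_mono) auto
    finally show ?thesis
      by (simp add: power_mult_distrib ac_simps)
  qed
  moreover have "B * K\<^sup>2 > 0"
    using B K by simp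
  ultimately show ?thesis
    using sm unfolding bessel_in_UNIV_iff eq by blast
qed

text \<open>Allows the weights of a multiplier to be absorbed into either of its two
  sequences.\<close>

lemma bessel_in_scaleC:
  fixes F :: "nat \<Rightarrow> 'a::complex_inner"
  assumes F: "bessel_in UNIV F" and m: "bounded (range m)"
  shows "bessel_in UNIV (\<lambda>n. m n *\<^sub>C F n)"
proof -
  obtain B where B: "B > 0"
    and sm: "\<And>h. summable (\<lambda>n. (cmod (cinner h (F n)))\<^sup>2)"
    and le: "\<And>h. (\<Sum>n. (cmod (cinner h (F n)))\<^sup>2) \<le> B * (norm h)\<^sup>2"
    using F unfolding bessel_in_UNIV_iff by blast
  obtain K where K: "K > 0" "\<And>n. cmod (m n) \<le> K"
    using m unfolding bounded_pos by blast
  have term_le: "(cmod (cinner h (m n *\<^sub>C F n)))\<^sup>2 \<le> K\<^sup>2 * (cmod (cinner h (F n)))\<^sup>2" for h n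
  proof -
    have "cmod (cinner h (m n *\<^sub>C F n)) \<le> K * cmod (cinner h (F n))"
      by (simp add: cinner_scaleC_right norm_mult mult_right_mono K(2))
    from power_mono[OF this, of 2] show ?thesis
      by (simp add: power_mult_distrib)
  qed
  have sm': "summable (\<lambda>n. (cmod (cinner h (m n *\<^sub>C F n)))\<^sup>2)" for h
    by (rule summable_comparison_test'[OF summable_mult[OF sm, of "K\<^sup>2"]])
      (use term_le in simp)
  have "(\<Sum>n. (cmod (cinner h (m n *\<^sub>C F n)))\<^sup>2) \<le> (K\<^sup>2 * B) * (norm h)\<^sup>2" for h
  proof -
    have "(\<Sum>n. (cmod (cinner h (m n *\<^sub>C F n)))\<^sup>2) \<le> (\<Sum>n. K\<^sup>2 * (cmod (cinner h (F n)))\<^sup>2)"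
      by (rule suminf_le[OF term_le sm' summable_mult[OF sm]])
    also have "\<dots> = K\<^sup>2 * (\<Sum>n. (cmod (cinner h (F n)))\<^sup>2)"
      by (rule suminf_mult[OF sm])
    also have "\<dots> \<le> K\<^sup>2 * (B * (norm h)\<^sup>2)"
      by (intro mult_left_mono le) simp
    finally show ?thesis
      by (simp add: ac_simps)
  qed
  moreover have "K\<^sup>2 * B > 0"
    using B K by simp
  ultimately show ?thesis
    using sm' unfolding bessel_in_UNIV_iff by blast
qed

section \<open>Synthesis and analysis operators of Bessel sequences\<close>

lemma synthesis_sums:
  fixes F :: "nat \<Rightarrow> 'a::chilbert_space"
  assumes "bessel_in UNIV F" and "c \<in> ell2"
  shows "(\<lambda>n. c n *\<^sub>C F n) sums synthesis F c"
  using synthesis_summable[OF assms] by (simp add: synthesis_def summable_sums)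

lemma synthesis_image:
  fixes F :: "nat \<Rightarrow> 'a::chilbert_space" and T :: "'a \<Rightarrow> 'b::chilbert_space"
  assumes "bessel_in UNIV F" and "c \<in> ell2" and T: "clinear T" "bounded_linear T"
  shows "synthesis (\<lambda>n. T (F n)) c = T (synthesis F c)"
  using sums_unique[OF bounded_linear.sums[OF T(2) synthesis_sums[OF assms(1,2)]]]
  by (simp add: synthesis_def clinear_scaleC[OF T(1)])

lemma analysis_adjoint_pair:
  assumes "adjoint_pair T S"
  shows "analysis (\<lambda>n. S (F n)) h = analysis F (T h)"
  using assms by (simp add: analysis_def adjoint_pair_def)

text \<open>Both inner products are sums of one and the same series, with terms
  \<open><h, G n> <F n, k>\<close>; one of them is reached through conjugation.\<close>

lemma synthesis_analysis_adjoint_pair: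
  fixes F :: "nat \<Rightarrow> 'a::chilbert_space" and G :: "nat \<Rightarrow> 'b::chilbert_space"
  assumes F: "bessel_in UNIV F" and G: "bessel_in UNIV G"
  shows "adjoint_pair (\<lambda>h. synthesis F (analysis G h)) (\<lambda>k. synthesis G (analysis F k))"
  unfolding adjoint_pair_def
proof (intro allI)
  fix h k
  have "(\<lambda>n. analysis G h n * cnj (analysis F k n)) sums cinner (synthesis F (analysis G h)) k"
    by (rule synthesis_analysis_adjoint[OF F analysis_in_ell2[OF G]])
  moreover have "(\<lambda>n. cnj (analysis F k n * cnj (analysis G h n)))
      sums cnj (cinner (synthesis G (analysis F k)) h)"
    unfolding sums_cnj by (rule synthesis_analysis_adjoint[OF G analysis_in_ell2[OF F]])
  ultimately show "cinner (synthesis F (analysis G h)) k = cinner h (synthesis G (analysis F k))"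
    by (simp add: cinner_commute[of h] mult.commute sums_unique2)
qed

text \<open>With \<open>s\<close> the synthesised vector, \<open>|s|^2\<close> is the series of
  \<open>c n\<close> against the coefficients of \<open>s\<close>. Young's inequality and the Bessel
  bound leave half of \<open>|s|^2\<close> on the right, to be absorbed.\<close>

lemma norm_synthesis_le:
  fixes F :: "nat \<Rightarrow> 'a::chilbert_space"
  assumes F: "bessel_in UNIV F"
  obtains B where "B > 0"
    and "\<And>c. c \<in> ell2 \<Longrightarrow> (norm (synthesis F c))\<^sup>2 \<le> B * (\<Sum>n. (cmod (c n))\<^sup>2)"
proof -
  obtain B where B: "B > 0"
    and sm: "\<And>h. summable (\<lambda>n. (cmod (cinner h (F n)))\<^sup>2)"
    and le: "\<And>h. (\<Sum>n. (cmod (cinner h (F n)))\<^sup>2) \<le> B * (norm h)\<^sup>2"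
    using F unfolding bessel_in_UNIV_iff by blast
  have "(norm (synthesis F c))\<^sup>2 \<le> B * (\<Sum>n. (cmod (c n))\<^sup>2)" if c: "c \<in> ell2" for c
  proof -
    define s where "s = synthesis F c"
    define L where "L = (\<Sum>n. (cmod (c n))\<^sup>2)"
    define D where "D = (\<Sum>n. (cmod (cinner s (F n)))\<^sup>2)"
    have smc: "summable (\<lambda>n. (cmod (c n))\<^sup>2)"
      using c by (simp add: ell2_def)
    have "(\<lambda>n. Re (c n * cnj (cinner s (F n)))) sums Re (cinner s s)"
      using sums_Re[OF synthesis_analysis_adjoint[OF F c, of s]] by (simp add: analysis_def s_def)
    \<comment> \<open>The weights are tuned so that the bound \<open>D \<le> B * (norm s)^2\<close>
      makes the second part at most \<open>(norm s)^2 / 2\<close>.\<close>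
    moreover have "(\<lambda>n. B / 2 * (cmod (c n))\<^sup>2 + inverse (2 * B) * (cmod (cinner s (F n)))\<^sup>2)
        sums (B / 2 * L + inverse (2 * B) * D)"
      unfolding L_def D_def by (intro sums_add sums_mult summable_sums smc sm)
    moreover have "Re (c n * cnj (cinner s (F n)))
        \<le> B / 2 * (cmod (c n))\<^sup>2 + inverse (2 * B) * (cmod (cinner s (F n)))\<^sup>2" for n
    proof -
      define p q where "p = cmod (c n)" and "q = cmod (cinner s (F n))"
      have "Re (c n * cnj (cinner s (F n))) \<le> p * q"
        using complex_Re_le_cmod[of "c n * cnj (cinner s (F n))"]
        by (simp add: norm_mult p_def q_def)
      also have "\<dots> \<le> B / 2 * p\<^sup>2 + inverse (2 * B) * q\<^sup>2"
      proof -
        have "0 \<le> (B * p - q)\<^sup>2 / (2 * B)"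
          using B by simp
        also have "\<dots> = B / 2 * p\<^sup>2 + inverse (2 * B) * q\<^sup>2 - p * q"
          using B by (simp add: field_simps power2_eq_square)
        finally show ?thesis
          by simp
      qed
      finally show ?thesis
        by (simp add: p_def q_def)
    qed
    ultimately have "Re (cinner s s) \<le> B / 2 * L + inverse (2 * B) * D"
      by (rule sums_le[rotated])
    then have "(norm s)\<^sup>2 \<le> B / 2 * L + inverse (2 * B) * D"
      by (simp add: cinner_self)
    also have "\<dots> \<le> B / 2 * L + inverse (2 * B) * (B * (norm s)\<^sup>2)"
      unfolding D_def using B by (intro add_left_mono mult_left_mono le) simp
    also have "inverse (2 * B) * (B * (norm s)\<^sup>2) = (norm s)\<^sup>2 / 2"
      using B by simp
    finally show ?thesis
      by (simp add: s_def L_def)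
  qed
  with B show thesis
    by (rule that)
qed

text \<open>Passing to the adjoint, \<open>|h|^2 = <h, T_G T_F^* h>\<close>, so \<open>|h|\<close>
  is at most the norm of \<open>T_G T_F^* h\<close>. A bound \<open>B\<close> for the squared norm
  of \<open>T_G\<close> therefore gives the lower frame bound \<open>1 / B\<close> for
  \<open>F\<close>.\<close>

lemma frame_for_reconstruction:
  fixes F G :: "nat \<Rightarrow> 'a::chilbert_space"
  assumes F: "bessel_in UNIV F" and G: "bessel_in UNIV G"
    and X: "closed_csubspace X" "range F \<subseteq> X"
    and rec: "\<And>h. h \<in> X \<Longrightarrow> synthesis F (analysis G h) = h"
  shows "frame_for X F"
proof -
  obtain B where B: "B > 0"
    and le: "\<And>c. c \<in> ell2 \<Longrightarrow> (norm (synthesis G c))\<^sup>2 \<le> B * (\<Sum>n. (cmod (c n))\<^sup>2)"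
    using norm_synthesis_le[OF G] by blast
  have "inverse B * (norm h)\<^sup>2 \<le> (\<Sum>n. (cmod (cinner h (F n)))\<^sup>2)" if "h \<in> X" for h
  proof -
    have "cinner h h = cinner h (synthesis G (analysis F h))"
      using synthesis_analysis_adjoint_pair[OF F G] rec[OF that]
      unfolding adjoint_pair_def by metis
    then have "(norm h)\<^sup>2 = cmod (cinner h (synthesis G (analysis F h)))"
      by (metis cinner_self norm_of_real abs_power2)
    then have "norm h * norm h \<le> norm h * norm (synthesis G (analysis F h))"
      using cmod_cinner_le by (metis power2_eq_square)
    then have "norm h \<le> norm (synthesis G (analysis F h))"
      by (cases "h = 0") auto
    then have "(norm h)\<^sup>2 \<le> (norm (synthesis G (analysis F h)))\<^sup>2"
      by (rule power_mono) simp
    also have "\<dots> \<le> B * (\<Sum>n. (cmod (cinner h (F n)))\<^sup>2)"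
      using le[OF analysis_in_ell2[OF F, of h]] by (simp add: analysis_def)
    finally show ?thesis
      using B by (simp add: field_simps)
  qed
  moreover have "inverse B > 0"
    using B by simp
  ultimately show ?thesis
    using bessel_in_subset[OF F X] unfolding frame_for_def by blast
qed

text \<open>The adjoint \<open>Q\<close> of the given projection maps into \<open>W2\<close>, and
  \<open>h - Q h\<close> is orthogonal to \<open>W1\<close>. This supplies the second decomposition
  and identifies \<open>Q\<close> as its projection.\<close>

lemma oblique_dual_pairI:
  fixes F G :: "nat \<Rightarrow> 'a::chilbert_space"
  assumes W1: "closed_csubspace W1" and W2: "closed_csubspace W2"
    and dir: "direct_sum W1 (ocomp W2)"
    and F: "bessel_in UNIV F" and FW: "range F \<subseteq> W1"
    and G: "bessel_in UNIV G" and GW: "range G \<subseteq> W2"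
    and eq: "\<And>h. synthesis F (analysis G h) = oblique_proj W1 (ocomp W2) h"
  shows "oblique_dual_pair W1 W2 F G"
proof -
  interpret P: oblique_decomposition W1 "ocomp W2"
    using W1 dir by unfold_locales (simp_all add: closed_csubspace_ocomp)
  define Q where "Q h = synthesis G (analysis F h)" for h
  have adj: "adjoint_pair P.P Q"
    using synthesis_analysis_adjoint_pair[OF F G] by (simp add: eq Q_def[abs_def])
  have Q_in: "Q h \<in> W2" for h
    unfolding Q_def
    by (rule sums_in_closed_csubspace[OF W2 GW synthesis_sums[OF G analysis_in_ell2[OF F]]])
  have diff_Q_in: "h - Q h \<in> ocomp W1" for h
    unfolding ocomp_def
  proof (intro CollectI ballI)
    fix y
    assume "y \<in> W1"
    then have "cinner h y = cinner (Q h) y"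
      using adjoint_pair_sym[OF adj] P.P_on_X by (simp add: adjoint_pair_def)
    then show "cinner (h - Q h) y = 0"
      by (simp add: cinner_diff_left)
  qed
  \<comment> \<open>Split \<open>h\<close> as \<open>P h + (h - P h)\<close>: the first summand is
    orthogonal to \<open>h\<close> because \<open>h\<close> lies in \<open>ocomp W1\<close>, the
    second because \<open>h\<close> lies in \<open>W2\<close>.\<close>
  have zero: "h = 0" if h: "h \<in> W2" "h \<in> ocomp W1" for h
  proof -
    have "cinner h (P.P h) = 0" "cinner (h - P.P h) h = 0"
      using h P.P_in[of h] P.diff_P_in[of h] by (auto simp: ocomp_def)
    then have "cinner h h = 0"
      by (simp add: cinner_diff_left cinner_eq_zero_commute[of "P.P h"])
    then show ?thesis
      by simp
  qed
  have "direct_sum W2 (ocomp W1)"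
    unfolding direct_sum_def
  proof (intro conjI allI)
    show "W2 \<inter> ocomp W1 = {0}"
      using zero closed_csubspace_zero[OF W2] closed_csubspace_zero[OF closed_csubspace_ocomp]
      by blast
    show "\<exists>x\<in>W2. \<exists>z\<in>ocomp W1. h = x + z" for h
      using Q_in diff_Q_in by (metis add.commute diff_add_cancel)
  qed
  then interpret Q: oblique_decomposition W2 "ocomp W1"
    using W2 by unfold_locales (simp_all add: closed_csubspace_ocomp)
  have Q_eq: "Q h = Q.P h" for h
    using Q.P_eqI[OF Q_in diff_Q_in] by simp
  have eq': "synthesis G (analysis F h) = Q.P h" for h
    by (simp add: Q_eq flip: Q_def)
  have "frame_for W1 F"
    by (rule frame_for_reconstruction[OF F G W1 FW]) (simp add: eq P.P_on_X)
  moreover have "frame_for W2 G"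
    by (rule frame_for_reconstruction[OF G F W2 GW]) (simp add: eq' Q.P_on_X)
  ultimately show ?thesis
    using W1 W2 eq eq' dir Q.XZ by (simp add: oblique_dual_pair_def oblique_dual_frame_def)
qed

theorem theorem5p3:
  fixes \<Psi> :: "nat \<Rightarrow> 'a::chilbert_space"
    and \<Phi> :: "nat \<Rightarrow> 'b::chilbert_space"
    and m :: "nat \<Rightarrow> complex"
    and M :: "'a \<Rightarrow> 'b"
    and W :: "'a set"
    and V :: "'b set"
    and Mpinv :: "'b \<Rightarrow> 'a"
    and \<Psi>pinv :: "nat \<Rightarrow> 'a"
    and \<Phi>pinv :: "nat \<Rightarrow> 'b"
  assumes "separable_space (euclidean :: 'a topology)"
    and "separable_space (euclidean :: 'b topology)"
    and "bessel_in UNIV \<Psi>"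
    and "bessel_in UNIV \<Phi>"
    and "bounded (range m)"
    and M_def: "M = multiplier m \<Phi> \<Psi>"
    and "closed (range M)"
    and "closed_csubspace W"
    and "closed_csubspace V"
    and "direct_sum W (ker M)"
    and "direct_sum (range M) V"
    and Mpinv_def: "Mpinv = oblique_pinv M W V"
    and \<Psi>pinv_def: "\<Psi>pinv = (\<lambda>n. Mpinv (m n *\<^sub>C \<Phi> n))"
    and \<Phi>pinv_def: "\<Phi>pinv = (\<lambda>n. cadjoint Mpinv (cnj (m n) *\<^sub>C \<Psi> n))"
  shows "frame_for (ocomp (ker M)) (\<lambda>n. cadjoint (oblique_proj W (ker M)) (\<Psi> n)) \<and>
    frame_for (range M) (\<lambda>n. oblique_proj (range M) V (\<Phi> n)) \<and>
    oblique_dual_pair (ocomp (ker M)) W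
      (\<lambda>n. cadjoint (oblique_proj W (ker M)) (\<Psi> n)) \<Psi>pinv \<and>
    oblique_dual_pair (range M) (ocomp V)
      (\<lambda>n. oblique_proj (range M) V (\<Phi> n)) \<Phi>pinv"
proof -
  \<comment> \<open>Absorbing the weights on either side gives two factorisations of
    \<open>M\<close>, one for each dual pair. On the analysis side they appear conjugated.\<close>
  define \<Psi>' where "\<Psi>' n = cnj (m n) *\<^sub>C \<Psi> n" for n
  define \<Phi>' where "\<Phi>' n = m n *\<^sub>C \<Phi> n" for n
  note \<Psi> = assms(3) and \<Phi> = assms(4)
  have "bounded (range (\<lambda>n. cnj (m n)))"
    using assms(5) by (simp add: bounded_pos)
  then have \<Psi>': "bessel_in UNIV \<Psi>'"
    using bessel_in_scaleC[OF \<Psi>] by (simp add: \<Psi>'_def[abs_def])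
  have \<Phi>': "bessel_in UNIV \<Phi>'"
    using bessel_in_scaleC[OF \<Phi> assms(5)] by (simp add: \<Phi>'_def[abs_def])
  have M1: "M h = synthesis \<Phi> (analysis \<Psi>' h)" for h
    by (simp add: M_def multiplier_def synthesis_def analysis_def \<Psi>'_def cinner_scaleC_right)
  have M2: "M h = synthesis \<Phi>' (analysis \<Psi> h)" for h
    by (simp add: M_def multiplier_def synthesis_def analysis_def \<Phi>'_def scaleC_scaleC
        mult.commute)
  have M_adj: "adjoint_pair M (\<lambda>k. synthesis \<Psi>' (analysis \<Phi> k))"
    using synthesis_analysis_adjoint_pair[OF \<Phi> \<Psi>'] by (simp flip: M1)
  have M_clin: "clinear M"
    by (rule adjoint_pair_clinear[OF M_adj])
  interpret \<pi>: oblique_decomposition W "ker M"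
    using assms adjoint_pair_closed_csubspace_ker[OF M_adj] by unfold_locales
  interpret \<rho>: oblique_decomposition "range M" V
    using assms clinear_closed_csubspace_range[OF M_clin] by unfold_locales
  interpret M: bounded_linear M
    by (rule adjoint_pair_bounded_linear[OF M_adj])

  have pinv_eqI: "Mpinv y = x" if x: "x \<in> W" "y - M x \<in> V" for x y
    unfolding Mpinv_def oblique_pinv_def
  proof (rule the_equality)
    show "x \<in> W \<and> (\<exists>z\<in>V. y = M x + z)"
      using x by (metis add.commute diff_add_cancel)
    fix x'
    assume "x' \<in> W \<and> (\<exists>z\<in>V. y = M x' + z)"
    then have x': "x' \<in> W" "y - M x' \<in> V"
      by auto
    \<comment> \<open>Uniqueness in two stages: the decomposition of the codomain fixes
      \<open>M x\<close>, then that of the domain fixes \<open>x\<close> within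
      \<open>W\<close>.\<close>
    have "M x' = M x"
      using \<rho>.P_unique x x' by blast
    then show "x' = x"
      using \<pi>.P_unique[of x x x'] x x' closed_csubspace_zero[OF \<pi>.Z]
      by (simp add: ker_def M.diff M.zero)
  qed
  have M_proj: "M (\<pi>.P h) = M h" for h
    using \<pi>.diff_P_in[of h] by (simp add: ker_def M.diff)
  have pinv: "Mpinv y \<in> W" "M (Mpinv y) = \<rho>.P y" for y
  proof -
    obtain h where h: "\<rho>.P y = M h"
      using \<rho>.P_in by blast
    \<comment> \<open>Projecting the preimage \<open>h\<close> onto \<open>W\<close> changes it only
      by an element of \<open>ker M\<close>, so its image is still
      \<open>\<rho>.P y\<close>.\<close>
    have "Mpinv y = \<pi>.P h"
      using \<pi>.P_in \<rho>.diff_P_in[of y] by (intro pinv_eqI) (simp_all add: M_proj h)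
    then show "Mpinv y \<in> W" "M (Mpinv y) = \<rho>.P y"
      by (simp_all add: \<pi>.P_in M_proj h)
  qed
  have pinv_M: "Mpinv (M h) = \<pi>.P h" for h
    by (rule pinv_eqI) (simp_all add: \<pi>.P_in M_proj closed_csubspace_zero \<rho>.Z)
  have pinv_V: "Mpinv v = 0" if "v \<in> V" for v
    using that by (intro pinv_eqI) (simp_all add: closed_csubspace_zero \<pi>.X M.zero)
  have pinv_clin: "clinear Mpinv"
    unfolding clinear_def
  proof (intro conjI allI pinv_eqI)
    fix x y a
    show "Mpinv x + Mpinv y \<in> W" "a *\<^sub>C Mpinv x \<in> W"
      using pinv \<pi>.X by (auto intro: closed_csubspace_add closed_csubspace_scaleC)
    show "x + y - M (Mpinv x + Mpinv y) \<in> V"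
      using \<rho>.diff_P_in[of "x + y"] \<rho>.P_clinear by (simp add: M.add pinv clinear_def)
    show "a *\<^sub>C x - M (a *\<^sub>C Mpinv x) \<in> V"
      using \<rho>.diff_P_in[of "a *\<^sub>C x"] \<rho>.P_clinear M_clin by (simp add: pinv clinear_def)
  qed
  have pinv_bl: "bounded_linear Mpinv"
  proof (rule closed_graph)
    show "linear Mpinv"
      by (rule clinear_imp_linear[OF pinv_clin])
    fix u x y
    assume u: "u \<longlonglongrightarrow> x" and pu: "(\<lambda>n. Mpinv (u n)) \<longlonglongrightarrow> y"
    show "Mpinv x = y"
    \<comment> \<open>Both conditions characterising the pseudoinverse pass to the limit, since
      \<open>W\<close> and \<open>V\<close> are closed and \<open>M\<close> is continuous.\<close>
    proof (rule pinv_eqI)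
      show "y \<in> W"
        by (rule closed_sequentially[OF closed_csubspace_closed[OF \<pi>.X] pinv(1) pu])
      show "x - M y \<in> V"
        by (rule closed_sequentially[OF closed_csubspace_closed[OF \<rho>.Z] _
              tendsto_diff[OF u M.tendsto[OF pu]]])
          (simp add: pinv \<rho>.diff_P_in)
    qed
  qed
  note pinv_adj = adjoint_pair_cadjoint[OF pinv_clin pinv_bl]

  \<comment> \<open>With \<open>W\<close> first, the mixed operator is \<open>Mpinv\<close> after
    \<open>M\<close> after \<open>\<pi>.P\<close>, which collapses to \<open>\<pi>.P\<close>. The
    order required by the claim follows from the symmetry of
    \<open>oblique_dual_pair\<close>.\<close>
  have pair1: "oblique_dual_pair W (ocomp (ker M)) \<Psi>pinv (\<lambda>n. cadjoint \<pi>.P (\<Psi> n))"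
  proof (rule oblique_dual_pairI)
    show "direct_sum W (ocomp (ocomp (ker M)))"
      by (simp add: \<pi>.biorthogonal_Z \<pi>.XZ)
    show "bessel_in UNIV \<Psi>pinv"
      using bessel_in_adjoint_pair[OF \<Phi>' pinv_adj] by (simp add: \<Psi>pinv_def \<Phi>'_def)
    show "bessel_in UNIV (\<lambda>n. cadjoint \<pi>.P (\<Psi> n))"
      by (rule bessel_in_adjoint_pair[OF \<Psi> adjoint_pair_sym[OF \<pi>.P_adjoint]])
    show "range \<Psi>pinv \<subseteq> W"
      using pinv by (auto simp: \<Psi>pinv_def)
    fix h
    have "synthesis \<Psi>pinv (analysis (\<lambda>n. cadjoint \<pi>.P (\<Psi> n)) h)
        = synthesis (\<lambda>n. Mpinv (\<Phi>' n)) (analysis \<Psi> (\<pi>.P h))"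
      by (simp add: analysis_adjoint_pair[OF \<pi>.P_adjoint] \<Psi>pinv_def \<Phi>'_def)
    also have "\<dots> = Mpinv (M (\<pi>.P h))"
      by (simp add: synthesis_image[OF \<Phi>' analysis_in_ell2[OF \<Psi>] pinv_clin pinv_bl] M2)
    finally show "synthesis \<Psi>pinv (analysis (\<lambda>n. cadjoint \<pi>.P (\<Psi> n)) h)
        = oblique_proj W (ocomp (ocomp (ker M))) h"
      by (simp add: M_proj pinv_M \<pi>.biorthogonal_Z)
  qed (auto simp: \<pi>.X closed_csubspace_ocomp \<pi>.cadjoint_P_in)

  have pair2: "oblique_dual_pair (range M) (ocomp V) (\<lambda>n. \<rho>.P (\<Phi> n)) \<Phi>pinv"
  proof (rule oblique_dual_pairI)
    show "direct_sum (range M) (ocomp (ocomp V))"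
      by (simp add: \<rho>.biorthogonal_Z \<rho>.XZ)
    show "bessel_in UNIV (\<lambda>n. \<rho>.P (\<Phi> n))"
      by (rule bessel_in_adjoint_pair[OF \<Phi> \<rho>.P_adjoint])
    show "bessel_in UNIV \<Phi>pinv"
      using bessel_in_adjoint_pair[OF \<Psi>' adjoint_pair_sym[OF pinv_adj]]
      by (simp add: \<Phi>pinv_def \<Psi>'_def)
    \<comment> \<open>The adjoint of \<open>Mpinv\<close> maps into \<open>ocomp V\<close> because
      \<open>Mpinv\<close> vanishes on \<open>V\<close>.\<close>
    show "range \<Phi>pinv \<subseteq> ocomp V"
      using adjoint_pair_sym[OF pinv_adj] pinv_V
      by (auto simp: ocomp_def adjoint_pair_def \<Phi>pinv_def)
    fix h
    have "synthesis (\<lambda>n. \<rho>.P (\<Phi> n)) (analysis \<Phi>pinv h)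
        = synthesis (\<lambda>n. \<rho>.P (\<Phi> n)) (analysis \<Psi>' (Mpinv h))"
      using analysis_adjoint_pair[OF pinv_adj, of \<Psi>' h] by (simp add: \<Phi>pinv_def \<Psi>'_def)
    \<comment> \<open>The projection is pulled out of the synthesis, and what remains is the
      factorisation \<open>M1\<close> evaluated at \<open>Mpinv h\<close>.\<close>
    also have "\<dots> = \<rho>.P (M (Mpinv h))"
      using synthesis_image[OF \<Phi> analysis_in_ell2[OF \<Psi>'] \<rho>.P_clinear \<rho>.P_bounded_linear]
      by (simp flip: M1)
    finally show "synthesis (\<lambda>n. \<rho>.P (\<Phi> n)) (analysis \<Phi>pinv h)
        = oblique_proj (range M) (ocomp (ocomp V)) h"
      by (simp add: pinv \<rho>.P_on_X \<rho>.P_in \<rho>.biorthogonal_Z)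
  qed (auto simp: \<rho>.X closed_csubspace_ocomp \<rho>.P_in)

  \<comment> \<open>The frame properties (i) and (ii) are components of the two dual pairs.\<close>
  show ?thesis
    using pair1 pair2 by (simp add: oblique_dual_pair_def oblique_dual_frame_def)
qed

end
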